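(* Let $\mathbb{K}$ be a field, $V$ a two-dimensional $\mathbb{K}$-vector space, and $\mathcal{A}$ a finite set of distinct one-dimensional linear subspaces of $V$. Let $\mu,\nu\in\Lambda'$ belong to distinct maximal connected components of $\Lambda'$ and satisfy $\Delta(\mu)+\Delta(\nu)=d(\mu,\nu)$. Let $\kappa\in\Lambda$ with $\mu\wedge\nu\subset\kappa\subset\mu\vee\nu$, and set $\alpha_{\mu,\kappa}=\prod_{H\in\mathcal{A}}\alpha_H^{\max\{\kappa_H-\mu_H,0\}}$ and $\alpha_{\nu,\kappa}=\prod_{H\in\mathcal{A}}\alpha_H^{\max\{\kappa_H-\nu_H,0\}}$. Then $\{\alpha_{\mu,\kappa}\theta_\mu,\alpha_{\nu,\kappa}\theta_\nu\}$ is a homogeneous basis of $D(\mathcal{A},\kappa)$.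
   Context: Let $S=\mathrm{Sym}(V^* )\cong\mathbb{K}[x,y]$, graded by polynomial degree; for $H\in\mathcal{A}$ fix $\alpha_H\in V^*$ with $\ker\alpha_H=H$. Let $\Lambda=\mathbb{N}^{|\mathcal{A}|}$, whose elements are multiplicities $\mu:\mathcal{A}\to\mathbb{N}$. For $\mu\in\Lambda$, $D(\mathcal{A},\mu)=\{\delta\in S\partial_x\oplus S\partial_y\mid \delta(\alpha_H)\in\alpha_H^{\mu_H}S\ \forall H\}$ is a free graded $S$-module of rank 2; if $(d_1,d_2)$ are the degrees of a homogeneous basis, $\Delta(\mu)=|d_1-d_2|$. Order $\Lambda$ componentwise, with $(\mu\wedge\nu)_H=\min\{\mu_H,\nu_H\}$, $(\mu\vee\nu)_H=\max\{\mu_H,\nu_H\}$; $|\mu|=\sum_H\mu_H$; $\mu\mathrel{\dot\subset}\nu$ means $\mu\subset\nu$ and $|\nu|=|\mu|+1$; the Hasse graph has edges $\{\mu,\nu\}$ with $\mu\mathrel{\dot\subset}\nu$, and connectivity of subsets of $\Lambda$ refers to the induced subgraph. $\Lambda'=\Delta^{-1}(\mathbb{Z}_{>0})$, $d(\mu,\nu)=\sum_H|\mu_H-\nu_H|$. For $\mu\in\Lambda'$, $\theta_\mu$ is the element of smaller degree in a homogeneous basis $\{\theta_\mu,\theta'_\mu\}$ of $D(\mathcal{A},\mu)$ with $\deg\theta_\mu<\deg\theta'_\mu$ (unique up to nonzero scalar). *)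

theory Defs
  imports Main "HOL-Library.FuncSet" "HOL-Library.Product_Plus" "HOL-Computational_Algebra.Polynomial"
begin

text \<open>
  The ring \<open>S = Sym(V\<^sup>*)\<close> is \<open>K[x,y]\<close> in the coordinates \<open>x, y\<close> dual to a basis
  \<open>e1, e2\<close> of \<open>V\<close>. It is represented as \<^typ>\<open>'k poly poly\<close>, i.e. \<open>K[x][y]\<close>:
  the coefficient of \<open>x\<^sup>i y\<^sup>j\<close> in \<open>p\<close> is \<open>coeff (coeff p j) i\<close>.
\<close>

text \<open>The linear form \<open>f = f(e1) x + f(e2) y\<close> as an element of \<open>K[x][y]\<close>.\<close>

definition form_poly :: "'v \<Rightarrow> 'v \<Rightarrow> ('v \<Rightarrow> 'k::field) \<Rightarrow> 'k poly poly" where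
  "form_poly e1 e2 f = [:[:0, f e1:], [:f e2:]:]"

definition homogeneous :: "nat \<Rightarrow> 'k::field poly poly \<Rightarrow> bool" where
  "homogeneous d p \<longleftrightarrow> (\<forall>i j. coeff (coeff p j) i \<noteq> 0 \<longrightarrow> i + j = d)"

text \<open>The pair \<open>(f, g)\<close> stands for the derivation \<open>f \<partial>\<^sub>x + g \<partial>\<^sub>y\<close>.\<close>

type_synonym 'k der = "'k poly poly \<times> 'k poly poly"

definition der_apply :: "'k::field der \<Rightarrow> 'k poly poly \<Rightarrow> 'k poly poly" where
  "der_apply \<delta> p = fst \<delta> * map_poly pderiv p + snd \<delta> * pderiv p"

definition der_scale :: "'k::field poly poly \<Rightarrow> 'k der \<Rightarrow> 'k der" where
  "der_scale p \<delta> = (p * fst \<delta>, p * snd \<delta>)"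

global_interpretation der: module der_scale
  by standard (auto simp: der_scale_def algebra_simps)

text \<open>Polynomial degree: \<open>\<partial>\<^sub>x\<close> and \<open>\<partial>\<^sub>y\<close> have degree 0.\<close>

definition der_homogeneous :: "nat \<Rightarrow> 'k::field der \<Rightarrow> bool" where
  "der_homogeneous d \<delta> \<longleftrightarrow> homogeneous d (fst \<delta>) \<and> homogeneous d (snd \<delta>)"

text \<open>
  A multiplicity \<open>A \<rightarrow> \<nat>\<close> is an extensional function, so \<open>\<le>\<close>, \<open>inf\<close> and \<open>sup\<close> on
  functions restrict to the componentwise order and lattice operations on \<open>\<Lambda>\<close>.
\<close>

definition Mult :: "'h set \<Rightarrow> ('h \<Rightarrow> nat) set" where
  "Mult A = A \<rightarrow>\<^sub>E UNIV"

text \<open>\<open>D(A, \<mu>)\<close>; here and below \<open>l H\<close> is the linear polynomial \<open>\<alpha>\<^sub>H\<close>.\<close>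

definition Dmod :: "'h set \<Rightarrow> ('h \<Rightarrow> 'k::field poly poly) \<Rightarrow> ('h \<Rightarrow> nat) \<Rightarrow> 'k der set" where
  "Dmod A l \<mu> = {\<delta>. \<forall>H\<in>A. l H ^ \<mu> H dvd der_apply \<delta> (l H)}"

definition homogeneous_basis_degs ::
    "'k::field der set \<Rightarrow> 'k der \<Rightarrow> 'k der \<Rightarrow> nat \<Rightarrow> nat \<Rightarrow> bool" where
  "homogeneous_basis_degs M \<theta> \<theta>' d d' \<longleftrightarrow>
     \<theta> \<noteq> \<theta>' \<and> der.independent {\<theta>, \<theta>'} \<and> der.span {\<theta>, \<theta>'} = M \<and>
     der_homogeneous d \<theta> \<and> der_homogeneous d' \<theta>'"

definition homogeneous_basis :: "'k::field der set \<Rightarrow> 'k der \<Rightarrow> 'k der \<Rightarrow> bool" where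
  "homogeneous_basis M \<theta> \<theta>' \<longleftrightarrow> (\<exists>d d'. homogeneous_basis_degs M \<theta> \<theta>' d d')"

text \<open>
  Well defined since \<open>D(A, \<mu>)\<close> is a free graded module of rank 2, so that a homogeneous basis
  exists and its degrees are unique up to order.
\<close>

definition Delta :: "'h set \<Rightarrow> ('h \<Rightarrow> 'k::field poly poly) \<Rightarrow> ('h \<Rightarrow> nat) \<Rightarrow> int" where
  "Delta A l \<mu> = (THE n. \<exists>\<theta> \<theta>' d d'. homogeneous_basis_degs (Dmod A l \<mu>) \<theta> \<theta>' d d' \<and>
                                     n = \<bar>int d - int d'\<bar>)"

definition Mult' :: "'h set \<Rightarrow> ('h \<Rightarrow> 'k::field poly poly) \<Rightarrow> ('h \<Rightarrow> nat) set" where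
  "Mult' A l = {\<mu> \<in> Mult A. Delta A l \<mu> > 0}"

text \<open>
  \<open>\<theta>\<close> is a possible choice of \<open>\<theta>\<^sub>\<mu>\<close>, which is only determined up to a nonzero scalar.
\<close>

definition is_theta ::
    "'h set \<Rightarrow> ('h \<Rightarrow> 'k::field poly poly) \<Rightarrow> ('h \<Rightarrow> nat) \<Rightarrow> 'k der \<Rightarrow> bool" where
  "is_theta A l \<mu> \<theta> \<longleftrightarrow>
     (\<exists>\<theta>' d d'. homogeneous_basis_degs (Dmod A l \<mu>) \<theta> \<theta>' d d' \<and> d < d')"

definition mult_dist :: "'h set \<Rightarrow> ('h \<Rightarrow> nat) \<Rightarrow> ('h \<Rightarrow> nat) \<Rightarrow> int" where
  "mult_dist A \<mu> \<nu> = (\<Sum>H\<in>A. \<bar>int (\<mu> H) - int (\<nu> H)\<bar>)"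

definition covered :: "'h set \<Rightarrow> ('h \<Rightarrow> nat) \<Rightarrow> ('h \<Rightarrow> nat) \<Rightarrow> bool" where
  "covered A \<mu> \<nu> \<longleftrightarrow> \<mu> \<le> \<nu> \<and> (\<Sum>H\<in>A. \<nu> H) = (\<Sum>H\<in>A. \<mu> H) + 1"

definition hasse :: "'h set \<Rightarrow> ('h \<Rightarrow> nat) rel" where
  "hasse A = {(\<mu>, \<nu>). \<mu> \<in> Mult A \<and> \<nu> \<in> Mult A \<and> (covered A \<mu> \<nu> \<or> covered A \<nu> \<mu>)}"

definition hasse_connected :: "'h set \<Rightarrow> ('h \<Rightarrow> nat) set \<Rightarrow> bool" where
  "hasse_connected A X \<longleftrightarrow> X \<subseteq> Mult A \<and> (\<forall>\<mu>\<in>X. \<forall>\<nu>\<in>X. (\<mu>, \<nu>) \<in> (Restr (hasse A) X)\<^sup>*)"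

definition hasse_components :: "'h set \<Rightarrow> ('h \<Rightarrow> nat) set \<Rightarrow> ('h \<Rightarrow> nat) set set" where
  "hasse_components A Y =
     {C. C \<noteq> {} \<and> C \<subseteq> Y \<and> hasse_connected A C \<and>
         (\<forall>C'. C \<subseteq> C' \<and> C' \<subseteq> Y \<and> hasse_connected A C' \<longrightarrow> C' = C)}"

text \<open>
  The product \<open>\<alpha>\<^sub>\<mu>\<^sub>,\<^sub>\<kappa>\<close>; truncated subtraction on \<^typ>\<open>nat\<close> is \<open>max {\<kappa>\<^sub>H - \<mu>\<^sub>H, 0}\<close>.
\<close>

definition alpha_prod ::
    "'h set \<Rightarrow> ('h \<Rightarrow> 'k::field poly poly) \<Rightarrow> ('h \<Rightarrow> nat) \<Rightarrow> ('h \<Rightarrow> nat) \<Rightarrow> 'k poly poly" where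
  "alpha_prod A l \<mu> \<kappa> = (\<Prod>H\<in>A. l H ^ (\<kappa> H - \<mu> H))"

end

theory Submission
  imports Defs "HOL-Computational_Algebra.Polynomial_Factorial"
begin

text \<open>
  By Saito's criterion it suffices to see that the two derivations lie in \<open>D(A, \<kappa>)\<close>, that their
  degrees add up to \<open>\<bar>\<kappa>\<bar>\<close>, and that their determinant is nonzero. The degree condition is the
  hypothesis \<open>\<Delta>(\<mu>) + \<Delta>(\<nu>) = d(\<mu>, \<nu>)\<close>. For the determinant, note that a nonzero derivation of degree
  less than \<open>\<bar>\<kappa>\<bar>/2\<close> in \<open>D(A, \<kappa>)\<close> forces \<open>\<Delta>(\<kappa>) > 0\<close>. Dividing \<open>\<theta>\<^sub>\<mu>\<close> and \<open>\<theta>\<^sub>\<nu>\<close> by forms \<open>\<alpha>\<^sub>H\<close> for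
  as long as possible, one walks inside \<open>\<Lambda>'\<close> down to \<open>\<mu>'\<close> and \<open>\<nu>'\<close>. If \<open>\<theta>\<^sub>\<mu>\<close> and \<open>\<theta>\<^sub>\<nu>\<close> were proportional, the
  resulting derivations would lie in the same modules \<open>D(A, \<sigma>)\<close>, and the one of smaller degree would show that
  all multiplicities between \<open>\<mu>'\<close> or \<open>\<nu>'\<close> and \<open>sup \<mu>' \<nu>'\<close> belong to \<open>\<Lambda>'\<close>; then \<open>\<mu>\<close> and \<open>\<nu>\<close>
  would be connected.
\<close>

lemma prime_elem_power_dvd_cancel:
  fixes p :: "'a::algebraic_semidom"
  assumes "prime_elem p" "\<not> p dvd c" "p ^ n dvd c * x"
  shows "p ^ n dvd x"
  using prime_elem_power_dvd_cases[of p n c x 1 n] assms by auto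

subsection \<open>Homogeneous polynomials\<close>

lemma homogeneous_0 [simp]: "homogeneous d 0"
  by (simp add: homogeneous_def)

lemma homogeneous_const [simp]: "homogeneous 0 [:[:c:]:]"
  by (auto simp: homogeneous_def coeff_pCons split: nat.splits if_splits)

lemma homogeneous_1 [simp]: "homogeneous 0 1"
  by (auto simp: homogeneous_def coeff_1 split: if_splits)

lemma homogeneous_linear: "homogeneous 1 [:[:0, a:], [:b:]:]"
  by (auto simp: homogeneous_def coeff_pCons split: nat.splits if_splits)

lemma homogeneous_add: "homogeneous d p \<Longrightarrow> homogeneous d q \<Longrightarrow> homogeneous d (p + q)"
  by (auto simp: homogeneous_def) (metis add.right_neutral)+

lemma homogeneous_diff: "homogeneous d p \<Longrightarrow> homogeneous d q \<Longrightarrow> homogeneous d (p - q)"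
  by (auto simp: homogeneous_def) (metis diff_zero right_minus_eq)

lemma coeff_coeff_mult:
  fixes p q :: "'a::comm_semiring_0 poly poly"
  shows "coeff (coeff (p * q) j) i =
     (\<Sum>j'\<le>j. \<Sum>i'\<le>i. coeff (coeff p j') i' * coeff (coeff q (j - j')) (i - i'))"
  by (simp add: coeff_mult coeff_sum)

lemma homogeneous_mult:
  assumes "homogeneous d p" "homogeneous e q"
  shows "homogeneous (d + e) (p * q)"
  unfolding homogeneous_def
proof (intro allI impI)
  fix i j
  assume "coeff (coeff (p * q) j) i \<noteq> 0"
  then obtain j' where "j' \<le> j" "(\<Sum>i'\<le>i. coeff (coeff p j') i' * coeff (coeff q (j - j')) (i - i')) \<noteq> 0"
    unfolding coeff_coeff_mult by (meson atMost_iff sum.neutral)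
  then obtain i' where "i' \<le> i" "coeff (coeff p j') i' * coeff (coeff q (j - j')) (i - i') \<noteq> 0"
    by (meson atMost_iff sum.neutral)
  then have "i' + j' = d" "(i - i') + (j - j') = e" 
    using assms by (auto simp: homogeneous_def)
  then show "i + j = d + e" using \<open>j' \<le> j\<close> \<open>i' \<le> i\<close> by simp
qed

lemma homogeneous_power: "homogeneous d p \<Longrightarrow> homogeneous (n * d) (p ^ n)"
  by (induction n) (auto intro: homogeneous_mult)

lemma homogeneous_prod:
  "finite A \<Longrightarrow> (\<And>x. x \<in> A \<Longrightarrow> homogeneous (d x) (f x)) \<Longrightarrow> homogeneous (\<Sum>x\<in>A. d x) (\<Prod>x\<in>A. f x)"
  by (induction A rule: finite_induct) (auto intro: homogeneous_mult)

definition homogeneous_part :: "nat \<Rightarrow> 'k::field poly poly \<Rightarrow> 'k poly poly" where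
  "homogeneous_part d p = (\<Sum>j\<le>d. monom (monom (coeff (coeff p j) (d - j)) (d - j)) j)"

lemma coeff_homogeneous_part:
  "coeff (coeff (homogeneous_part d p) j) i = (if i + j = d then coeff (coeff p j) i else 0)"
proof -
  have "coeff (homogeneous_part d p) j = (if j \<le> d then monom (coeff (coeff p j) (d - j)) (d - j) else 0)"
    by (simp add: homogeneous_part_def coeff_sum sum.delta)
  then show ?thesis by auto
qed

lemma homogeneous_homogeneous_part: "homogeneous d (homogeneous_part d p)"
  by (simp add: homogeneous_def coeff_homogeneous_part)

lemma poly_poly_eqI: "(\<And>i j. coeff (coeff p j) i = coeff (coeff q j) i) \<Longrightarrow> p = q"
  by (simp add: poly_eq_iff)

lemma homogeneous_part_ident: "homogeneous d p \<Longrightarrow> homogeneous_part d p = p"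
  by (rule poly_poly_eqI) (auto simp: coeff_homogeneous_part homogeneous_def)

text \<open>A nonzero term of \<open>q\<close> has degree \<open>e\<close>, so in a product
  contributing to degree \<open>d + e\<close> its partner in \<open>r\<close> has degree
  \<open>d\<close>.\<close>

lemma homogeneous_part_mult:
  assumes "homogeneous e q"
  shows "homogeneous_part (d + e) (r * q) = homogeneous_part d r * q"
proof (rule poly_poly_eqI)
  fix i j
  have "coeff (coeff (r * q) j) i = coeff (coeff (homogeneous_part d r * q) j) i" if "i + j = d + e"
    unfolding coeff_coeff_mult
  proof (intro sum.cong refl)
    fix j' i' assume "j' \<in> {..j}" "i' \<in> {..i}"
    then have "i' + j' = d" if "coeff (coeff q (j - j')) (i - i') \<noteq> 0"
      using assms that \<open>i + j = d + e\<close> by (force simp: homogeneous_def)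
    then show "coeff (coeff r j') i' * coeff (coeff q (j - j')) (i - i') =
        coeff (coeff (homogeneous_part d r) j') i' * coeff (coeff q (j - j')) (i - i')"
      by (auto simp: coeff_homogeneous_part)
  qed
  moreover have "homogeneous (d + e) (homogeneous_part d r * q)"
    by (intro homogeneous_mult homogeneous_homogeneous_part assms)
  ultimately show "coeff (coeff (homogeneous_part (d + e) (r * q)) j) i = coeff (coeff (homogeneous_part d r * q) j) i"
    unfolding coeff_homogeneous_part by (auto simp: homogeneous_def)
qed

text \<open>A nonzero coefficient of \<open>p\<close> contains a summand with a nonzero coefficient
  of \<open>q\<close> whose indices do not exceed its own. Comparing index sums suffices, so
  \<open>r\<close> may be inhomogeneous.\<close>

lemma homogeneous_dvd_degree_le:
  assumes "homogeneous d p" "homogeneous e q" "p = r * q" "p \<noteq> 0"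
  shows "e \<le> d"
proof -
  obtain i j where "coeff (coeff p j) i \<noteq> 0" using \<open>p \<noteq> 0\<close> by (metis poly_poly_eqI coeff_0)
  then have "i + j = d" "coeff (coeff (r * q) j) i \<noteq> 0" using assms by (auto simp: homogeneous_def)
  from this(2) obtain j' where "j' \<le> j" "(\<Sum>i'\<le>i. coeff (coeff r j') i' * coeff (coeff q (j - j')) (i - i')) \<noteq> 0"
    unfolding coeff_coeff_mult by (meson atMost_iff sum.neutral)
  then obtain i' where "i' \<le> i" "coeff (coeff r j') i' * coeff (coeff q (j - j')) (i - i') \<noteq> 0"
    by (meson atMost_iff sum.neutral)
  then have "(i - i') + (j - j') = e" using assms by (auto simp: homogeneous_def)
  then show ?thesis using \<open>i + j = d\<close> by linarith
qed

text \<open>Taking the part of degree \<open>d + e\<close> fixes \<open>r * q\<close> and replaces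
  \<open>r\<close> by its part of degree \<open>d\<close>; cancelling \<open>q\<close> shows that
  \<open>r\<close> equals that part.\<close>

lemma homogeneous_quotient:
  assumes "homogeneous (d + e) (r * q)" "homogeneous e q" "q \<noteq> 0"
  shows "homogeneous d r"
proof -
  have "homogeneous_part d r * q = r * q"
    using assms by (metis homogeneous_part_ident homogeneous_part_mult)
  then show ?thesis using \<open>q \<noteq> 0\<close> by (metis homogeneous_homogeneous_part mult_cancel_right)
qed

lemma homogeneous_0_imp_const:
  assumes "homogeneous 0 p"
  obtains c where "p = [:[:c:]:]"
proof
  show "p = [:[:coeff (coeff p 0) 0:]:]"
    using assms by (intro poly_poly_eqI) (auto simp: homogeneous_def coeff_pCons split: nat.splits)
qed

section \<open>Linear forms: primality and evaluation at a zero\<close>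

lemma linear_form_dvd_iff:
  fixes a b :: "'k::field"
  assumes "b \<noteq> 0"
  shows "[:[:0, a:], [:b:]:] dvd p \<longleftrightarrow> poly p [:0, -a/b:] = 0"
proof -
  \<comment> \<open>Up to the unit \<open>b\<close>, the form is monic of degree 1 in
    \<open>y\<close> over \<open>K[x]\<close>, so the factor theorem applies.\<close>
  have eq: "[:[:0, a:], [:b:]:] = [:[:b:]:] * [:-[:0, -a/b:], 1:]" using assms by simp
  have "is_unit [:[:b:]:]" using assms by (simp add: is_unit_const_poly_iff dvd_field_iff)
  then show ?thesis unfolding eq poly_eq_0_iff_dvd by (subst mult_unit_dvd_iff') auto
qed

text \<open>For \<open>b = 0\<close> the form is a prime of \<open>K[x]\<close>, which stays prime
  in \<open>K[x][y]\<close>. Otherwise divisibility means vanishing at a point of the domain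
  \<open>K[x]\<close>, and this is a prime condition.\<close>

lemma prime_elem_linear_form:
  fixes a b :: "'k::field"
  assumes "a \<noteq> 0 \<or> b \<noteq> 0"
  shows "prime_elem [:[:0, a:], [:b:]:]"
proof (cases "b = 0")
  case True
  have "prime_elem [:0, a:]" using assms True prime_elem_linear_field_poly by simp
  then show ?thesis using True lift_prime_elem_poly by simp
next
  case False
  show ?thesis unfolding prime_elem_def using False by (auto simp: linear_form_dvd_iff)
qed

text \<open>The point \<open>(x, y)\<close> spans the zero line of the form, and a homogeneous
  polynomial restricted to that line is a power of the parameter times its value at the point. The
  linear form \<open>u\<close>, normalised to 1 there, later serves to raise degrees without
  changing values at the point.\<close>

lemma linear_form_dvd_iff_root:
  fixes a b :: "'k::field"
  assumes "a \<noteq> 0 \<or> b \<noteq> 0"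
  obtains x y u where "homogeneous 1 u" "poly (poly u [:y:]) x = 1"
    "\<And>d p. homogeneous d p \<Longrightarrow> [:[:0, a:], [:b:]:] dvd p \<longleftrightarrow> poly (poly p [:y:]) x = 0"
proof (cases "b = 0")
  case True
  have "homogeneous 1 [:0, 1::'k poly:]" using homogeneous_linear[of 0 1] by (simp add: one_pCons)
  moreover have "[:[:0, a:], [:b:]:] dvd p \<longleftrightarrow> poly (poly p [:1:]) 0 = 0" if p: "homogeneous d p" for d p
  proof -
    have dvd: "[:0, a:] dvd p \<longleftrightarrow> coeff p 0 = 0" for p
    proof -
      have "[:0, a:] = smult a [:0, 1:]" by simp
      then show ?thesis using assms True by (metis smult_dvd_iff pCons_0_0 poly_0_coeff_0 poly_eq_0_iff_dvd minus_zero)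
    qed
    have "[:[:0, a:], [:b:]:] dvd p \<longleftrightarrow> (\<forall>j. coeff (coeff p j) 0 = 0)"
      using True by (simp add: const_poly_dvd_iff dvd)
    \<comment> \<open>By homogeneity the only term free of \<open>x\<close> is the one in
      \<open>y^d\<close>, and its coefficient is the value at \<open>(0, 1)\<close>.\<close>
    also have "\<dots> \<longleftrightarrow> coeff (coeff p d) 0 = 0" using p unfolding homogeneous_def by (metis add_0)
    also have "coeff (coeff p d) 0 = poly (poly p [:1:]) 0"
    proof -
      have "poly (poly p [:1:]) 0 = poly (poly (homogeneous_part d p) [:1:]) 0"
        by (simp add: homogeneous_part_ident p)
      also have "\<dots> = (\<Sum>j\<le>d. coeff (coeff p j) (d - j) * 0 ^ (d - j))"
        by (simp add: homogeneous_part_def poly_sum poly_monom)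
      also have "\<dots> = (\<Sum>j\<le>d. if j = d then coeff (coeff p d) 0 else 0)"
        by (intro sum.cong) auto
      finally show ?thesis by simp
    qed
    finally show ?thesis .
  qed
  ultimately show ?thesis by (intro that[of "[:0,1:]" 1 0]) auto
next
  case False
  have "homogeneous 1 [:[:0, 1::'k:]:]" using homogeneous_linear[of 1 0] by simp
  moreover have "[:[:0, a:], [:b:]:] dvd p \<longleftrightarrow> poly (poly p [:-a/b:]) 1 = 0" if p: "homogeneous d p" for d p
  proof -
    define s where "s = - a / b"
    have s: "[:0, s:] = monom s 1" by (simp add: monom_altdef)
    \<comment> \<open>Substituting \<open>y = s x\<close> turns each monomial of degree
      \<open>d\<close> into a constant times \<open>x^d\<close>.\<close>
    have "poly (homogeneous_part d p) [:0, s:] = monom (poly (poly (homogeneous_part d p) [:s:]) 1) d"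
      by (simp add: homogeneous_part_def poly_sum poly_monom s monom_power mult_monom monom_sum poly_power)
    then have "poly p [:0, s:] = monom (poly (poly p [:s:]) 1) d"
      by (simp add: homogeneous_part_ident p)
    then show ?thesis unfolding linear_form_dvd_iff[OF False] s_def by (simp add: monom_eq_0_iff)
  qed
  ultimately show ?thesis by (intro that[of "[:[:0,1:]:]" "-a/b" 1]) auto
qed

subsection \<open>Saito's criterion\<close>

lemma der_apply_add: "der_apply (\<delta> + \<delta>') p = der_apply \<delta> p + der_apply \<delta>' p"
  by (simp add: der_apply_def algebra_simps)

lemma der_apply_diff: "der_apply (\<delta> - \<delta>') p = der_apply \<delta> p - der_apply \<delta>' p"
  by (simp add: der_apply_def algebra_simps)

lemma der_apply_scale: "der_apply (der_scale p \<delta>) q = p * der_apply \<delta> q"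
  by (simp add: der_apply_def der_scale_def algebra_simps)

lemma der_apply_linear_form:
  "der_apply \<delta> [:[:0, a:], [:b:]:] = fst \<delta> * [:[:a:]:] + snd \<delta> * [:[:b:]:]"
  by (simp add: der_apply_def map_poly_pCons pderiv_pCons)

lemma der_homogeneous_scale:
  "homogeneous d p \<Longrightarrow> der_homogeneous e \<delta> \<Longrightarrow> der_homogeneous (d + e) (der_scale p \<delta>)"
  by (auto simp: der_homogeneous_def der_scale_def intro: homogeneous_mult)

definition der_det :: "'k::field der \<Rightarrow> 'k der \<Rightarrow> 'k poly poly" where
  "der_det \<delta> \<delta>' = fst \<delta> * snd \<delta>' - snd \<delta> * fst \<delta>'"

lemma homogeneous_der_det:
  "der_homogeneous d \<delta> \<Longrightarrow> der_homogeneous d' \<delta>' \<Longrightarrow> homogeneous (d + d') (der_det \<delta> \<delta>')"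
  unfolding der_homogeneous_def der_det_def by (blast intro: homogeneous_diff homogeneous_mult)

lemma der_det_scale:
  "der_det (der_scale p \<delta>) (der_scale q \<delta>') = p * q * der_det \<delta> \<delta>'"
  by (simp add: der_det_def der_scale_def algebra_simps)

lemma der_det_cramer:
  "der_scale (der_det \<theta> \<theta>') \<delta> = der_scale (der_det \<delta> \<theta>') \<theta> + der_scale (der_det \<theta> \<delta>) \<theta>'"
  by (simp add: der_det_def der_scale_def algebra_simps)

lemma der_det_combine:
  "der_det (der_scale a \<theta> + der_scale b \<theta>') (der_scale a' \<theta> + der_scale b' \<theta>') =
     (a * b' - b * a') * der_det \<theta> \<theta>'"
  by (simp add: der_det_def der_scale_def algebra_simps)

lemma der_scale_cancel:
  fixes p :: "'k::field poly poly"
  shows "p \<noteq> 0 \<Longrightarrow> der_scale p \<delta> = der_scale p \<delta>' \<longleftrightarrow> \<delta> = \<delta>'"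
  by (auto simp: der_scale_def prod_eq_iff)

lemma der_span_pair: "\<delta> \<in> der.span {\<theta>, \<theta>'} \<longleftrightarrow> (\<exists>a b. \<delta> = der_scale a \<theta> + der_scale b \<theta>')"
  by (auto simp: der.span_insert der.span_singleton algebra_simps)

lemma der_det_nonzero_independent:
  assumes "der_det \<theta> \<theta>' \<noteq> 0"
  shows "\<theta> \<noteq> \<theta>' \<and> der.independent {\<theta>, \<theta>'}"
proof -
  have "\<theta> \<noteq> \<theta>'" using assms by (auto simp: der_det_def algebra_simps)
  moreover have "a = 0 \<and> b = 0" if "der_scale a \<theta> + der_scale b \<theta>' = 0" for a b
  proof -
    have "a * der_det \<theta> \<theta>' = der_det (der_scale a \<theta> + der_scale b \<theta>') \<theta>'"
      "b * der_det \<theta> \<theta>' = der_det \<theta> (der_scale a \<theta> + der_scale b \<theta>')"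
      by (simp_all add: der_det_def der_scale_def algebra_simps)
    then show ?thesis using assms unfolding that by (simp add: der_det_def)
  qed
  ultimately show ?thesis 
    by (auto simp: der.dependent_finite)
qed

section \<open>Multiarrangements given by pairwise non-proportional linear forms\<close>

locale line_arrangement =
  fixes A :: "'h set" and l :: "'h \<Rightarrow> 'k::field poly poly"
  assumes finite_A: "finite A"
    and linear_form: "H \<in> A \<Longrightarrow> \<exists>a b. (a \<noteq> 0 \<or> b \<noteq> 0) \<and> l H = [:[:0, a:], [:b:]:]"
    and l_not_dvd: "H \<in> A \<Longrightarrow> K \<in> A \<Longrightarrow> H \<noteq> K \<Longrightarrow> \<not> l H dvd l K"
begin

lemma prime_l: "H \<in> A \<Longrightarrow> prime_elem (l H)"
  using linear_form prime_elem_linear_form by metis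

lemma homogeneous_l: "H \<in> A \<Longrightarrow> homogeneous 1 (l H)"
  using linear_form homogeneous_linear by metis

lemma l_nonzero: "H \<in> A \<Longrightarrow> l H \<noteq> 0"
  using prime_l by force

lemma homogeneous_der_apply:
  assumes "der_homogeneous d \<theta>" "H \<in> A"
  shows "homogeneous d (der_apply \<theta> (l H))"
proof -
  obtain a b where "l H = [:[:0, a:], [:b:]:]" using linear_form assms by blast
  then have "der_apply \<theta> (l H) = fst \<theta> * [:[:a:]:] + snd \<theta> * [:[:b:]:]"
    by (simp only: der_apply_linear_form)
  then show ?thesis
    using assms(1) homogeneous_mult[OF _ homogeneous_const, of d]
    by (simp only: der_homogeneous_def) (auto intro!: homogeneous_add)
qed

text \<open>Multiplying the determinant by a coefficient of \<open>l H\<close> produces a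
  combination of the two values at \<open>l H\<close>. At least one of these coefficients is a
  unit.\<close>

lemma dvd_der_det:
  assumes "H \<in> A" "p dvd der_apply \<theta> (l H)" "p dvd der_apply \<theta>' (l H)"
  shows "p dvd der_det \<theta> \<theta>'"
proof -
  obtain a b where ab: "a \<noteq> 0 \<or> b \<noteq> 0" "l H = [:[:0, a:], [:b:]:]"
    using linear_form assms by blast
  have unit: "is_unit [:[:c:]:]" if "c \<noteq> 0" for c :: 'k
    using that by (simp add: is_unit_const_poly_iff dvd_field_iff)
  have "[:[:a:]:] * der_det \<theta> \<theta>' = der_apply \<theta> (l H) * snd \<theta>' - snd \<theta> * der_apply \<theta>' (l H)"
    "[:[:b:]:] * der_det \<theta> \<theta>' = fst \<theta> * der_apply \<theta>' (l H) - fst \<theta>' * der_apply \<theta> (l H)"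
    unfolding ab(2) der_apply_linear_form der_det_def by algebra+
  then have "p dvd [:[:a:]:] * der_det \<theta> \<theta>'" "p dvd [:[:b:]:] * der_det \<theta> \<theta>'"
    using assms by (auto intro!: dvd_diff)
  then show ?thesis using ab(1) unit dvd_mult_unit_iff' by blast
qed

lemma Dmod_scale: "\<theta> \<in> Dmod A l \<kappa> \<Longrightarrow> der_scale p \<theta> \<in> Dmod A l \<kappa>"
  by (simp add: Dmod_def der_apply_scale)

lemma Dmod_add: "\<theta> \<in> Dmod A l \<kappa> \<Longrightarrow> \<theta>' \<in> Dmod A l \<kappa> \<Longrightarrow> \<theta> + \<theta>' \<in> Dmod A l \<kappa>"
  by (simp add: Dmod_def der_apply_add)

lemma Dmod_diff: "\<theta> \<in> Dmod A l \<kappa> \<Longrightarrow> \<theta>' \<in> Dmod A l \<kappa> \<Longrightarrow> \<theta> - \<theta>' \<in> Dmod A l \<kappa>"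
  by (simp add: Dmod_def der_apply_diff)

lemma Dmod_antimono: "\<kappa> \<le> \<kappa>' \<Longrightarrow> \<theta> \<in> Dmod A l \<kappa>' \<Longrightarrow> \<theta> \<in> Dmod A l \<kappa>"
  unfolding Dmod_def by (auto simp: le_fun_def intro: power_le_dvd)

text \<open>The defining polynomial of the multiarrangement.\<close>

definition Q :: "('h \<Rightarrow> nat) \<Rightarrow> 'k poly poly" where
  "Q \<kappa> = (\<Prod>H\<in>A. l H ^ \<kappa> H)"

definition mult_size :: "('h \<Rightarrow> nat) \<Rightarrow> nat" where
  "mult_size \<kappa> = (\<Sum>H\<in>A. \<kappa> H)"

lemma homogeneous_Q: "homogeneous (mult_size \<kappa>) (Q \<kappa>)"
  unfolding Q_def mult_size_def
  by (intro homogeneous_prod finite_A) (use homogeneous_power[OF homogeneous_l] in simp)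

lemma Q_nonzero: "Q \<kappa> \<noteq> 0"
  unfolding Q_def using finite_A l_nonzero by simp

text \<open>The \<open>l H\<close> are primes none of which divides another. Adding one line at a
  time, the product already split off is not divisible by the new prime, so the full power of that
  prime divides the cofactor.\<close>

lemma Q_dvdI:
  assumes "\<And>H. H \<in> A \<Longrightarrow> l H ^ \<kappa> H dvd p"
  shows "Q \<kappa> dvd p"
proof -
  have "(\<Prod>H\<in>B. l H ^ \<kappa> H) dvd p" if "finite B" "B \<subseteq> A" for B
    using that
  proof (induction B rule: finite_induct)
    case (insert K B)
    then obtain q where q: "p = (\<Prod>H\<in>B. l H ^ \<kappa> H) * q" by auto
    have "\<not> l K dvd (\<Prod>H\<in>B. l H ^ \<kappa> H)"
      using \<open>finite B\<close> \<open>insert K B \<subseteq> A\<close> \<open>K \<notin> B\<close>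
    proof (induction B rule: finite_induct)
      case empty
      then show ?case using prime_l by (simp add: prime_elem_not_unit)
    next
      case (insert H B)
      then show ?case
        using prime_l[of K] l_not_dvd[of K H] prime_elem_dvd_power[of "l K" "l H"]
        by (auto simp: prime_elem_dvd_mult_iff)
    qed
    then have "l K ^ \<kappa> K dvd q"
      using insert q prime_l[of K] assms[of K] prime_elem_power_dvd_cancel by blast
    then show ?case using insert q by (auto simp: ac_simps)
  qed simp
  then show ?thesis using finite_A by (simp add: Q_def)
qed

lemma Q_dvd_der_det: "\<theta> \<in> Dmod A l \<kappa> \<Longrightarrow> \<theta>' \<in> Dmod A l \<kappa> \<Longrightarrow> Q \<kappa> dvd der_det \<theta> \<theta>'"
  by (intro Q_dvdI dvd_der_det) (auto simp: Dmod_def)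

text \<open>\<open>Q \<kappa>\<close> divides the determinant and has the same degree, so the
  quotient is a nonzero constant. In Cramer's identity for an arbitrary member of the module all
  determinants are multiples of \<open>Q \<kappa>\<close>; cancelling it and inverting the constant
  gives the coordinates.\<close>

lemma saito_criterion:
  assumes "\<theta> \<in> Dmod A l \<kappa>" "\<theta>' \<in> Dmod A l \<kappa>" "der_homogeneous d \<theta>" "der_homogeneous d' \<theta>'"
    and "der_det \<theta> \<theta>' \<noteq> 0" "d + d' = mult_size \<kappa>"
  shows "homogeneous_basis_degs (Dmod A l \<kappa>) \<theta> \<theta>' d d'"
proof -
  obtain r where r: "der_det \<theta> \<theta>' = r * Q \<kappa>"
    using Q_dvd_der_det[OF assms(1,2)] by (metis dvdE mult.commute)
  have "homogeneous (0 + mult_size \<kappa>) (r * Q \<kappa>)"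
    using homogeneous_der_det[OF assms(3,4)] assms(6) r by simp
  then have "homogeneous 0 r" using homogeneous_Q Q_nonzero by (rule homogeneous_quotient)
  then obtain c where c: "r = [:[:c:]:]" by (rule homogeneous_0_imp_const)
  have "c \<noteq> 0" using r c assms(5) by auto
  have "\<delta> \<in> der.span {\<theta>, \<theta>'}" if \<delta>: "\<delta> \<in> Dmod A l \<kappa>" for \<delta>
  proof -
    obtain a b where ab: "der_det \<delta> \<theta>' = Q \<kappa> * a" "der_det \<theta> \<delta> = Q \<kappa> * b"
      using Q_dvd_der_det[OF \<delta> assms(2)] Q_dvd_der_det[OF assms(1) \<delta>] unfolding dvd_def by blast
    have "der_scale (Q \<kappa>) (der_scale r \<delta>) = der_scale (Q \<kappa>) (der_scale a \<theta> + der_scale b \<theta>')"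
      using der_det_cramer[of \<theta> \<theta>' \<delta>] unfolding r ab by (simp add: der_scale_def algebra_simps)
    then have "der_scale r \<delta> = der_scale a \<theta> + der_scale b \<theta>'"
      using Q_nonzero der_scale_cancel by blast
    then have "der_scale [:[:1 / c:]:] (der_scale r \<delta>) =
        der_scale ([:[:1 / c:]:] * a) \<theta> + der_scale ([:[:1 / c:]:] * b) \<theta>'"
      by (simp only: der.scale_right_distrib der.scale_scale)
    moreover have "der_scale [:[:1 / c:]:] (der_scale r \<delta>) = \<delta>"
      using \<open>c \<noteq> 0\<close> c by (simp add: der_scale_def flip: one_pCons)
    ultimately show ?thesis unfolding der_span_pair by metis
  qed
  moreover have "\<delta> \<in> Dmod A l \<kappa>" if "\<delta> \<in> der.span {\<theta>, \<theta>'}" for \<delta>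
    using that assms(1,2) unfolding der_span_pair by (auto intro: Dmod_add Dmod_scale)
  ultimately show ?thesis
    using assms der_det_nonzero_independent unfolding homogeneous_basis_degs_def by blast
qed

lemma mult_size_Suc: "H \<in> A \<Longrightarrow> mult_size (\<kappa>(H := Suc n)) = Suc (mult_size (\<kappa>(H := n)))"
  using finite_A by (simp add: mult_size_def sum.remove)

lemma Dmod_updateI:
  assumes "\<theta> \<in> Dmod A l (\<kappa>(H := n))" "l H ^ m dvd der_apply \<theta> (l H)"
  shows "\<theta> \<in> Dmod A l (\<kappa>(H := m))"
  using assms by (auto simp: Dmod_def split: if_splits)

text \<open>
  Induction on \<open>\<bar>\<kappa>\<bar>\<close>: restricted to the line \<open>H\<close>, a homogeneous polynomial is determined by its value at one
  point, so a multiple of the generator of smaller degree can be subtracted from the other one to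
  gain one more factor \<open>l H\<close>.
\<close>

lemma saito_pair_exists:
  "\<exists>\<theta> \<theta>' d d'. \<theta> \<in> Dmod A l \<kappa> \<and> \<theta>' \<in> Dmod A l \<kappa> \<and> der_homogeneous d \<theta> \<and> der_homogeneous d' \<theta>' \<and>
     der_det \<theta> \<theta>' \<noteq> 0 \<and> d + d' = mult_size \<kappa> \<and> d \<le> d'"
proof -
  let ?P = "\<lambda>\<kappa> \<theta> \<theta>' d d'. \<theta> \<in> Dmod A l \<kappa> \<and> \<theta>' \<in> Dmod A l \<kappa> \<and>
     der_homogeneous d \<theta> \<and> der_homogeneous d' \<theta>' \<and> der_det \<theta> \<theta>' \<noteq> 0 \<and> d + d' = mult_size \<kappa>"
  \<comment> \<open>The induction hypothesis must supply \<open>d \<le> d'\<close>, since a multiple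
    of the first derivation is subtracted from the second; the new pair may have its degrees in the
    wrong order.\<close>
  have swap: "\<exists>\<theta> \<theta>' d d'. ?P \<kappa> \<theta> \<theta>' d d' \<and> d \<le> d'" if "?P \<kappa> \<theta> \<theta>' d d'" for \<kappa> \<theta> \<theta>' d d'
  proof (cases "d \<le> d'")
    case False
    have "der_det \<theta>' \<theta> = - der_det \<theta> \<theta>'" by (simp add: der_det_def)
    then have "?P \<kappa> \<theta>' \<theta> d' d" using that by simp
    then show ?thesis using False nat_le_linear by blast
  qed (use that in blast)
  have "\<exists>\<theta> \<theta>' d d'. ?P \<kappa> \<theta> \<theta>' d d' \<and> d \<le> d'"
  proof (induction "mult_size \<kappa>" arbitrary: \<kappa>)
    case 0
    then have "Dmod A l \<kappa> = UNIV" using finite_A by (auto simp: Dmod_def mult_size_def)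
    then have "?P \<kappa> (1, 0) (0, 1) 0 0"
      using 0 by (simp add: der_homogeneous_def der_det_def)
    then show ?case by blast
  next
    case (Suc n)
    then obtain H where H: "H \<in> A" "\<kappa> H \<noteq> 0"
      unfolding mult_size_def by (metis sum.neutral nat.distinct(1))
    then obtain m where m: "\<kappa> H = Suc m" using not0_implies_Suc by blast
    define \<kappa>' where "\<kappa>' = \<kappa>(H := m)"
    have \<kappa>: "\<kappa> = \<kappa>'(H := Suc m)" using m by (auto simp: \<kappa>'_def)
    have size: "mult_size \<kappa> = Suc (mult_size \<kappa>')" using mult_size_Suc[OF H(1), of \<kappa> m] m by (simp add: \<kappa>'_def fun_upd_idem)
    have promote: "\<delta> \<in> Dmod A l \<kappa>" if "\<delta> \<in> Dmod A l \<kappa>'" "l H ^ Suc m dvd der_apply \<delta> (l H)" for \<delta>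
      using Dmod_updateI[of \<delta> \<kappa>' H m "Suc m"] that unfolding \<kappa>[symmetric] by (simp add: \<kappa>'_def)
    have promote_scale: "der_scale (l H) \<delta> \<in> Dmod A l \<kappa>" if "\<delta> \<in> Dmod A l \<kappa>'" for \<delta>
    proof (rule promote)
      have "l H ^ m dvd der_apply \<delta> (l H)" using that H(1) by (auto simp: Dmod_def \<kappa>'_def)
      then show "l H ^ Suc m dvd der_apply (der_scale (l H) \<delta>) (l H)"
        by (simp add: der_apply_scale mult_dvd_mono)
    qed (rule Dmod_scale[OF that])
    from Suc size obtain \<theta> \<theta>' d d' where basis: "?P \<kappa>' \<theta> \<theta>' d d'" and "d \<le> d'" by fastforce
    have hom: "der_homogeneous (Suc e) (der_scale (l H) \<delta>)" if "der_homogeneous e \<delta>" for e \<delta>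
      using der_homogeneous_scale[OF homogeneous_l[OF H(1)] that] by simp
    have "\<exists>\<theta> \<theta>' d d'. ?P \<kappa> \<theta> \<theta>' d d'"
    proof (cases "l H ^ Suc m dvd der_apply \<theta> (l H)")
      case True
      have "der_det \<theta> (der_scale (l H) \<theta>') = l H * der_det \<theta> \<theta>'"
        by (simp add: der_det_def der_scale_def algebra_simps)
      then have "?P \<kappa> \<theta> (der_scale (l H) \<theta>') d (Suc d')"
        using basis True promote promote_scale hom size l_nonzero[OF H(1)] by auto
      then show ?thesis by blast
    next
      case False
      obtain a b where ab: "a \<noteq> 0 \<or> b \<noteq> 0" "l H = [:[:0, a:], [:b:]:]"
        using linear_form H(1) by blast
      obtain x y u where u: "homogeneous 1 u" "poly (poly u [:y:]) x = 1"
        and root: "\<And>d p. homogeneous d p \<Longrightarrow> l H dvd p \<longleftrightarrow> poly (poly p [:y:]) x = 0"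
        using linear_form_dvd_iff_root[OF ab(1)] unfolding ab(2) by metis
      have "l H ^ m dvd der_apply \<theta> (l H)" "l H ^ m dvd der_apply \<theta>' (l H)"
        using basis H(1) by (auto simp: Dmod_def \<kappa>'_def)
      then obtain f f' where f: "der_apply \<theta> (l H) = f * l H ^ m"
        and f': "der_apply \<theta>' (l H) = f' * l H ^ m"
        by (metis dvdE mult.commute)
      have lm: "homogeneous m (l H ^ m)" "l H ^ m \<noteq> 0"
        using homogeneous_power[OF homogeneous_l[OF H(1)], of m] l_nonzero[OF H(1)] by simp_all
      have hom_f: "homogeneous d (f * l H ^ m)" "homogeneous d' (f' * l H ^ m)"
        using homogeneous_der_apply[OF _ H(1)] basis f f' by metis+
      have "f * l H ^ m \<noteq> 0" using False f by auto
      \<comment> \<open>This makes the truncated differences \<open>d - m\<close> and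
        \<open>d' - m\<close> the true degrees of the cofactors.\<close>
      then have "m \<le> d" using homogeneous_dvd_degree_le[OF hom_f(1) lm(1)] by blast
      then have f_hom: "homogeneous (d - m) f" "homogeneous (d' - m) f'"
        using homogeneous_quotient[OF _ lm, of "d - m" f] homogeneous_quotient[OF _ lm, of "d' - m" f']
          hom_f \<open>d \<le> d'\<close> by simp_all
      define c where "c = poly (poly f [:y:]) x"
      have "\<not> l H dvd f" using False f by (auto simp: mult_dvd_mono)
      then have "c \<noteq> 0" using root[OF f_hom(1)] by (simp add: c_def)
      \<comment> \<open>The constant makes \<open>f' - g * f\<close> vanish at the chosen point,
        where \<open>u\<close> is 1; the power of \<open>u\<close> gives \<open>g\<close> the degree
        \<open>d' - d\<close>, which keeps the difference homogeneous.\<close>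
      define g where "g = [:[:poly (poly f' [:y:]) x / c:]:] * u ^ (d' - d)"
      have g: "homogeneous (d' - d) g"
        unfolding g_def using homogeneous_mult[OF homogeneous_const homogeneous_power[OF u(1)]] by simp
      have "homogeneous (d' - m) (f' - g * f)"
        using homogeneous_diff[OF f_hom(2)] homogeneous_mult[OF g f_hom(1)] \<open>m \<le> d\<close> \<open>d \<le> d'\<close> by simp
      moreover have "poly (poly (f' - g * f) [:y:]) x = 0"
        using \<open>c \<noteq> 0\<close> u(2) by (simp add: g_def poly_power flip: c_def)
      ultimately have "l H dvd f' - g * f" using root by blast
      define \<delta> where "\<delta> = \<theta>' - der_scale g \<theta>"
      have "der_apply \<delta> (l H) = l H ^ m * (f' - g * f)"
        by (simp add: \<delta>_def der_apply_diff der_apply_scale f f' algebra_simps)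
      then have "l H ^ Suc m dvd der_apply \<delta> (l H)"
        using \<open>l H dvd f' - g * f\<close> by (simp add: mult.commute[of "l H"] mult_dvd_mono)
      moreover have "\<delta> \<in> Dmod A l \<kappa>'" unfolding \<delta>_def using basis by (intro Dmod_diff Dmod_scale) auto
      ultimately have "\<delta> \<in> Dmod A l \<kappa>" by (rule promote[rotated])
      moreover have "der_homogeneous d' \<delta>"
        using der_homogeneous_scale[OF g, of d \<theta>] basis \<open>d \<le> d'\<close>
        by (auto simp: \<delta>_def der_homogeneous_def intro: homogeneous_diff)
      \<comment> \<open>Subtracting a multiple of \<open>\<theta>\<close> leaves the determinant
        unchanged, so only the factor \<open>l H\<close> appears.\<close>
      moreover have "der_det (der_scale (l H) \<theta>) \<delta> = l H * der_det \<theta> \<theta>'"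
        by (simp add: \<delta>_def der_det_def der_scale_def algebra_simps)
      ultimately have "?P \<kappa> (der_scale (l H) \<theta>) \<delta> (Suc d) d'"
        using basis promote_scale hom size l_nonzero[OF H(1)] by auto
      then show ?thesis by blast
    qed
    then show ?case using swap by blast
  qed
  then show ?thesis by blast
qed

section \<open>Degrees of homogeneous bases and the value of \<open>Delta\<close>\<close>

lemma homogeneous_basis_degsD:
  assumes "homogeneous_basis_degs (Dmod A l \<kappa>) \<theta> \<theta>' d d'"
  shows "\<theta> \<in> Dmod A l \<kappa>" "\<theta>' \<in> Dmod A l \<kappa>" "der_homogeneous d \<theta>" "der_homogeneous d' \<theta>'"
    and "der_det \<theta> \<theta>' \<noteq> 0" "d + d' = mult_size \<kappa>"
proof -
  have span: "der.span {\<theta>, \<theta>'} = Dmod A l \<kappa>"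
    using assms by (simp add: homogeneous_basis_degs_def)
  show mem: "\<theta> \<in> Dmod A l \<kappa>" "\<theta>' \<in> Dmod A l \<kappa>"
    using der.span_base unfolding span[symmetric] by blast+
  show hom: "der_homogeneous d \<theta>" "der_homogeneous d' \<theta>'"
    using assms by (simp_all add: homogeneous_basis_degs_def)
  \<comment> \<open>A reference pair of the right degree sum. Its determinant is a multiple of that
    of any generating pair, which bounds \<open>d + d'\<close> from above; divisibility by
    \<open>Q \<kappa>\<close> bounds it from below.\<close>
  obtain \<phi> \<phi>' e e' where \<phi>: "\<phi> \<in> Dmod A l \<kappa>" "\<phi>' \<in> Dmod A l \<kappa>" "der_homogeneous e \<phi>" "der_homogeneous e' \<phi>'"
    "der_det \<phi> \<phi>' \<noteq> 0" "e + e' = mult_size \<kappa>"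
    using saito_pair_exists by blast
  obtain r where r: "der_det \<phi> \<phi>' = r * der_det \<theta> \<theta>'"
    using \<phi>(1,2) der_det_combine unfolding span[symmetric] der_span_pair by metis
  then show nz: "der_det \<theta> \<theta>' \<noteq> 0" using \<phi>(5) by auto
  obtain q where q: "der_det \<theta> \<theta>' = q * Q \<kappa>"
    using Q_dvd_der_det[OF mem] by (metis dvdE mult.commute)
  have "d + d' \<le> mult_size \<kappa>"
    using homogeneous_dvd_degree_le[OF homogeneous_der_det[OF \<phi>(3,4)] homogeneous_der_det[OF hom] r] \<phi> by simp
  moreover have "mult_size \<kappa> \<le> d + d'"
    using homogeneous_dvd_degree_le[OF homogeneous_der_det[OF hom] homogeneous_Q q nz] .
  ultimately show "d + d' = mult_size \<kappa>" by simp
qed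

text \<open>Each coordinate of \<open>\<theta>\<close> is a ratio of determinants. If the first is
  nonzero, comparing degrees gives \<open>e + e' \<le> d + e'\<close>; if the second is,
  \<open>e + e' \<le> e + d\<close>.\<close>

lemma basis_degs_min:
  assumes basis: "homogeneous_basis_degs (Dmod A l \<kappa>) \<phi> \<phi>' e e'"
    and "\<theta> \<in> Dmod A l \<kappa>" "\<theta> \<noteq> 0" "der_homogeneous d \<theta>"
  shows "min e e' \<le> d"
proof -
  note b = homogeneous_basis_degsD[OF basis]
  obtain a c where ac: "\<theta> = der_scale a \<phi> + der_scale c \<phi>'"
    using assms(1,2) unfolding homogeneous_basis_degs_def by (metis der_span_pair)
  have det: "der_det \<theta> \<phi>' = a * der_det \<phi> \<phi>'" "der_det \<phi> \<theta> = c * der_det \<phi> \<phi>'"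
    by (simp_all add: ac der_det_def der_scale_def algebra_simps)
  have "a \<noteq> 0 \<or> c \<noteq> 0" using ac assms(3) by auto
  then show ?thesis
    using homogeneous_dvd_degree_le[OF homogeneous_der_det[OF assms(4) b(4)] homogeneous_der_det[OF b(3,4)] det(1)]
      homogeneous_dvd_degree_le[OF homogeneous_der_det[OF b(3) assms(4)] homogeneous_der_det[OF b(3,4)] det(2)]
      b(5) det by auto
qed

text \<open>Two homogeneous bases have the same smaller degree, by minimality in both directions,
  and the same degree sum, hence the same difference.\<close>

lemma Delta_eq:
  assumes basis: "homogeneous_basis_degs (Dmod A l \<kappa>) \<theta> \<theta>' d d'"
  shows "Delta A l \<kappa> = \<bar>int d - int d'\<bar>"
  unfolding Delta_def
proof (rule the_equality)
  fix n
  assume "\<exists>\<phi> \<phi>' e e'. homogeneous_basis_degs (Dmod A l \<kappa>) \<phi> \<phi>' e e' \<and> n = \<bar>int e - int e'\<bar>"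
  then obtain \<phi> \<phi>' e e' where \<phi>: "homogeneous_basis_degs (Dmod A l \<kappa>) \<phi> \<phi>' e e'" and n: "n = \<bar>int e - int e'\<bar>"
    by blast
  have min_le: "min e1 e2 \<le> min d1 d2"
    if "homogeneous_basis_degs (Dmod A l \<kappa>) \<psi>1 \<psi>2 e1 e2" and "homogeneous_basis_degs (Dmod A l \<kappa>) \<psi> \<psi>' d1 d2"
    for \<psi>1 \<psi>2 \<psi> \<psi>' e1 e2 d1 d2
  proof -
    note b = homogeneous_basis_degsD[OF that(2)]
    have "\<psi> \<noteq> 0" "\<psi>' \<noteq> 0" using b(5) by (auto simp: der_det_def)
    then show ?thesis using basis_degs_min[OF that(1)] b by (meson min.boundedI)
  qed
  show "n = \<bar>int d - int d'\<bar>"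
    using min_le[OF \<phi> basis] min_le[OF basis \<phi>] homogeneous_basis_degsD(6)[OF \<phi>] homogeneous_basis_degsD(6)[OF basis] n by linarith
qed (use basis in blast)

subsection \<open>Paths in the Hasse graph\<close>

text \<open>A witness for membership in \<open>Mult' A l\<close> that can be carried along a path:
  \<open>\<theta>\<close> need not belong to a basis, and the strict inequality rules out equal
  basis degrees.\<close>

definition certifies :: "('h \<Rightarrow> nat) \<Rightarrow> 'k der \<Rightarrow> nat \<Rightarrow> bool" where
  "certifies \<kappa> \<theta> d \<longleftrightarrow>
     \<kappa> \<in> Mult A \<and> \<theta> \<in> Dmod A l \<kappa> \<and> \<theta> \<noteq> 0 \<and> der_homogeneous d \<theta> \<and> 2 * d < mult_size \<kappa>"

lemma certifies_imp_Mult':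
  assumes "certifies \<kappa> \<theta> d"
  shows "\<kappa> \<in> Mult' A l"
proof -
  obtain \<phi> \<phi>' e e' where basis: "homogeneous_basis_degs (Dmod A l \<kappa>) \<phi> \<phi>' e e'"
    using saito_pair_exists[of \<kappa>] saito_criterion by blast
  have "min e e' \<le> d" using basis_degs_min[OF basis] assms unfolding certifies_def by blast
  then have "Delta A l \<kappa> > 0"
    unfolding Delta_eq[OF basis] using homogeneous_basis_degsD(6)[OF basis] assms by (auto simp: certifies_def)
  then show ?thesis using assms by (simp add: Mult'_def certifies_def)
qed

definition adjacency :: "('h \<Rightarrow> nat) rel" where
  "adjacency = Restr (hasse A) (Mult' A l)"

lemma sym_adjacency: "sym adjacency"
  by (auto simp: adjacency_def hasse_def sym_def)

lemma path_sym: "(\<kappa>, \<kappa>') \<in> adjacency\<^sup>* \<Longrightarrow> (\<kappa>', \<kappa>) \<in> adjacency\<^sup>*"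
  using sym_adjacency sym_rtrancl symD by metis

lemma covered_adjacency:
  assumes "covered A \<kappa> \<kappa>'" "certifies \<kappa> \<theta> d" "certifies \<kappa>' \<theta>' d'"
  shows "(\<kappa>, \<kappa>') \<in> adjacency"
  using assms certifies_imp_Mult'[OF assms(2)] certifies_imp_Mult'[OF assms(3)]
  by (auto simp: adjacency_def hasse_def certifies_def)

lemma mult_size_mono: "\<kappa> \<le> \<kappa>' \<Longrightarrow> mult_size \<kappa> \<le> mult_size \<kappa>'"
  unfolding mult_size_def by (intro sum_mono) (simp add: le_fun_def)

lemma update_in_Mult: "\<kappa> \<in> Mult A \<Longrightarrow> H \<in> A \<Longrightarrow> \<kappa>(H := n) \<in> Mult A"
  by (auto simp: Mult_def PiE_iff extensional_def)

lemma covered_update: "H \<in> A \<Longrightarrow> covered A (\<kappa>(H := n)) (\<kappa>(H := Suc n))"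
  using mult_size_Suc[of H \<kappa> n] by (auto simp: covered_def le_fun_def mult_size_def)

text \<open>Throughout the interval from \<open>\<kappa>\<close> to \<open>\<kappa>'\<close> the
  same \<open>\<theta>\<close> is a certificate: the modules only grow downwards, and no size drops
  below that of \<open>\<kappa>\<close>. Hence single coordinates can be raised one by one.\<close>

lemma path_up:
  assumes "\<kappa> \<le> \<kappa>'" "\<kappa> \<in> Mult A" "certifies \<kappa>' \<theta> d" "2 * d < mult_size \<kappa>"
  shows "(\<kappa>, \<kappa>') \<in> adjacency\<^sup>*"
  using assms
proof (induction "mult_size \<kappa>' - mult_size \<kappa>" arbitrary: \<kappa> rule: less_induct)
  case less
  have certifies: "certifies \<rho> \<theta> d" if "\<kappa> \<le> \<rho>" "\<rho> \<le> \<kappa>'" "\<rho> \<in> Mult A" for \<rho>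
    using less.prems that mult_size_mono[OF that(1)] Dmod_antimono[OF that(2)] by (auto simp: certifies_def)
  show ?case
  proof (cases "\<kappa> = \<kappa>'")
    case False
    then obtain H where "\<kappa> H \<noteq> \<kappa>' H" by blast
    moreover from this have "H \<in> A"
      using less.prems PiE_arb[of _ A] unfolding certifies_def Mult_def by metis
    moreover have "\<kappa> H \<le> \<kappa>' H" using less.prems(1) by (simp add: le_fun_def)
    ultimately have H: "H \<in> A" "\<kappa> H < \<kappa>' H" by simp_all
    let ?\<rho> = "\<kappa>(H := Suc (\<kappa> H))"
    have \<rho>: "\<kappa> \<le> ?\<rho>" "?\<rho> \<le> \<kappa>'" "?\<rho> \<in> Mult A"
      using less.prems H update_in_Mult by (auto simp: le_fun_def)
    have "covered A \<kappa> ?\<rho>" using covered_update[OF H(1), of \<kappa> "\<kappa> H"] by simp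
    then have step: "(\<kappa>, ?\<rho>) \<in> adjacency"
      using covered_adjacency certifies \<rho> less.prems by blast
    have "mult_size ?\<rho> = Suc (mult_size \<kappa>)" using mult_size_Suc[OF H(1), of \<kappa> "\<kappa> H"] by simp
    then have "(?\<rho>, \<kappa>') \<in> adjacency\<^sup>*"
      using less.hyps[of ?\<rho>] less.prems \<rho> mult_size_mono[OF \<rho>(2)] by simp
    then show ?thesis using step by (rule converse_rtrancl_into_rtrancl[rotated])
  qed simp
qed

text \<open>Removing a common factor \<open>l H\<close> lowers the degree by 1 and the size by at
  most 1, so \<open>2 * d < mult_size \<kappa>\<close> survives, and each removal follows at most
  one edge. Induction on the degree ends at a derivation without common factor among the
  forms.\<close>

lemma divide_out:
  assumes "certifies \<kappa> \<theta> d"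
  shows "\<exists>\<kappa>' \<theta>' d' p. certifies \<kappa>' \<theta>' d' \<and> (\<kappa>, \<kappa>') \<in> adjacency\<^sup>* \<and> \<theta> = der_scale p \<theta>' \<and>
    (\<forall>H\<in>A. \<not> (l H dvd fst \<theta>' \<and> l H dvd snd \<theta>'))"
  using assms
proof (induction d arbitrary: \<kappa> \<theta> rule: less_induct)
  case (less d)
  show ?case
  proof (cases "\<forall>H\<in>A. \<not> (l H dvd fst \<theta> \<and> l H dvd snd \<theta>)")
    case True
    then show ?thesis using less.prems by (metis der.scale_one rtrancl.rtrancl_refl)
  next
    case False
    then obtain H f g where H: "H \<in> A" "fst \<theta> = l H * f" "snd \<theta> = l H * g" by (auto elim!: dvdE)
    define \<delta> where "\<delta> = (f, g)"
    have \<theta>: "\<theta> = der_scale (l H) \<delta>" using H by (simp add: \<delta>_def der_scale_def prod_eq_iff)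
    have hom: "homogeneous d (f * l H)" "homogeneous d (g * l H)"
      using less.prems H by (simp_all add: certifies_def der_homogeneous_def mult.commute)
    have "f \<noteq> 0 \<or> g \<noteq> 0" using less.prems H by (auto simp: certifies_def prod_eq_iff)
    then have "1 \<le> d"
      using homogeneous_dvd_degree_le[OF _ homogeneous_l[OF H(1)]] hom l_nonzero[OF H(1)]
      by (metis mult_eq_0_iff)
    then have "der_homogeneous (d - 1) \<delta>"
      using homogeneous_quotient[OF _ homogeneous_l[OF H(1)] l_nonzero[OF H(1)], of "d - 1"] hom
      by (simp add: der_homogeneous_def \<delta>_def)
    \<comment> \<open>If \<open>\<kappa> H = 0\<close>, truncated subtraction leaves
      \<open>\<kappa>\<close> in place and only the derivation changes.\<close>
    define \<kappa>' where "\<kappa>' = \<kappa>(H := \<kappa> H - 1)"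
    have size: "mult_size \<kappa> \<le> Suc (mult_size \<kappa>')"
      using mult_size_Suc[OF H(1), of \<kappa> "\<kappa> H - 1"] by (cases "\<kappa> H") (auto simp: \<kappa>'_def fun_upd_idem)
    have "\<delta> \<in> Dmod A l \<kappa>'"
      unfolding Dmod_def
    proof (intro CollectI ballI)
      fix K assume "K \<in> A"
      then have dvd: "l K ^ \<kappa> K dvd l H * der_apply \<delta> (l K)"
        using less.prems by (simp add: certifies_def Dmod_def \<theta> der_apply_scale)
      show "l K ^ \<kappa>' K dvd der_apply \<delta> (l K)"
      proof (cases "K = H")
        case True
        then show ?thesis
          using dvd l_nonzero[OF H(1)] by (cases "\<kappa> H") (auto simp: \<kappa>'_def)
      next
        case False
        then show ?thesis
          using prime_elem_power_dvd_cancel[OF prime_l[OF \<open>K \<in> A\<close>] _ dvd] l_not_dvd \<open>K \<in> A\<close> H(1)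
          by (simp add: \<kappa>'_def)
      qed
    qed
    moreover have "\<delta> \<noteq> 0" using \<open>f \<noteq> 0 \<or> g \<noteq> 0\<close> by (auto simp: \<delta>_def zero_prod_def)
    ultimately have cert: "certifies \<kappa>' \<delta> (d - 1)"
      using less.prems \<open>der_homogeneous (d - 1) \<delta>\<close> size \<open>1 \<le> d\<close> update_in_Mult[OF _ H(1)]
      by (auto simp: certifies_def \<kappa>'_def)
    have path: "(\<kappa>, \<kappa>') \<in> adjacency\<^sup>*"
    proof (cases "\<kappa> H")
      case 0
      then show ?thesis by (simp add: \<kappa>'_def fun_upd_idem)
    next
      case (Suc n)
      then have "covered A \<kappa>' \<kappa>" using covered_update[OF H(1), of \<kappa> n] by (simp add: \<kappa>'_def fun_upd_idem)
      then show ?thesis using covered_adjacency cert less.prems path_sym by blast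
    qed
    obtain \<kappa>'' \<delta>' e p where IH: "certifies \<kappa>'' \<delta>' e" "(\<kappa>', \<kappa>'') \<in> adjacency\<^sup>*" "\<delta> = der_scale p \<delta>'"
      "\<forall>H\<in>A. \<not> (l H dvd fst \<delta>' \<and> l H dvd snd \<delta>')"
      using less.IH[OF _ cert] \<open>1 \<le> d\<close> by auto
    then have "\<theta> = der_scale (l H * p) \<delta>'" by (simp add: \<theta>)
    then show ?thesis using IH rtrancl_trans[OF path IH(2)] by blast
  qed
qed

text \<open>Proportionality makes both components of \<open>\<theta>\<close>, multiplied by the
  value of \<open>\<theta>'\<close> at \<open>l H\<close>, divisible by the required power. The
  prime \<open>l H\<close> misses one of the components, so the power divides the value
  itself.\<close>

lemma Dmod_proportional:
  assumes "\<theta> \<in> Dmod A l \<kappa>" "\<forall>H\<in>A. \<not> (l H dvd fst \<theta> \<and> l H dvd snd \<theta>)" "der_det \<theta> \<theta>' = 0"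
  shows "\<theta>' \<in> Dmod A l \<kappa>"
  unfolding Dmod_def
proof (intro CollectI ballI)
  fix H assume H: "H \<in> A"
  have "fst \<theta> * der_apply \<theta>' (l H) = fst \<theta>' * der_apply \<theta> (l H)"
    "snd \<theta> * der_apply \<theta>' (l H) = snd \<theta>' * der_apply \<theta> (l H)"
    using assms(3) unfolding der_det_def der_apply_def by algebra+
  moreover have "l H ^ \<kappa> H dvd der_apply \<theta> (l H)" using assms(1) H by (simp add: Dmod_def)
  ultimately have "l H ^ \<kappa> H dvd fst \<theta> * der_apply \<theta>' (l H)" "l H ^ \<kappa> H dvd snd \<theta> * der_apply \<theta>' (l H)"
    by simp_all
  then show "l H ^ \<kappa> H dvd der_apply \<theta>' (l H)"
    using prime_elem_power_dvd_cancel[OF prime_l[OF H]] assms(2) H by blast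
qed

lemma path_if_proportional:
  assumes "certifies \<mu> \<theta> d" "certifies \<nu> \<theta>' d'" "der_det \<theta> \<theta>' = 0"
  shows "(\<mu>, \<nu>) \<in> adjacency\<^sup>*"
proof -
  obtain \<mu>' \<phi> e p where \<phi>: "certifies \<mu>' \<phi> e" "(\<mu>, \<mu>') \<in> adjacency\<^sup>*" "\<theta> = der_scale p \<phi>"
    "\<forall>H\<in>A. \<not> (l H dvd fst \<phi> \<and> l H dvd snd \<phi>)"
    using divide_out[OF assms(1)] by blast
  obtain \<nu>' \<psi> e' q where \<psi>: "certifies \<nu>' \<psi> e'" "(\<nu>, \<nu>') \<in> adjacency\<^sup>*" "\<theta>' = der_scale q \<psi>"
    "\<forall>H\<in>A. \<not> (l H dvd fst \<psi> \<and> l H dvd snd \<psi>)"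
    using divide_out[OF assms(2)] by blast
  have "p \<noteq> 0" "q \<noteq> 0" using assms(1,2) \<phi>(3) \<psi>(3) by (auto simp: certifies_def)
  then have det: "der_det \<phi> \<psi> = 0" "der_det \<psi> \<phi> = 0"
    using assms(3) unfolding \<phi>(3) \<psi>(3) der_det_scale by (auto simp: der_det_def ac_simps)
  \<comment> \<open>The exponent of \<open>sup \<rho> \<sigma>\<close> at each line is one of the
    two given ones, so \<open>\<phi>\<close> lies in its module. From \<open>e \<le> e'\<close> the
    bound \<open>2 * e\<close> is below both sizes, so \<open>\<phi>\<close> certifies an ascent
    from either side.\<close>
  have join: "(\<rho>, \<sigma>) \<in> adjacency\<^sup>*"
    if "certifies \<rho> \<phi> e" "certifies \<sigma> \<psi> e'" "\<phi> \<in> Dmod A l \<sigma>" "e \<le> e'" for \<rho> \<sigma> \<phi> \<psi> e e'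
  proof -
    have \<rho>\<sigma>: "\<rho> \<le> sup \<rho> \<sigma>" "\<sigma> \<le> sup \<rho> \<sigma>" by simp_all
    have "sup \<rho> \<sigma> \<in> Mult A"
      using that by (auto simp: certifies_def Mult_def PiE_iff extensional_def)
    moreover have "\<phi> \<in> Dmod A l (sup \<rho> \<sigma>)"
      using that by (auto simp: certifies_def Dmod_def sup_max max_def)
    ultimately have sup: "certifies (sup \<rho> \<sigma>) \<phi> e"
      using that mult_size_mono[OF \<rho>\<sigma>(1)] by (auto simp: certifies_def)
    have "\<rho> \<in> Mult A" "2 * e < mult_size \<rho>" "\<sigma> \<in> Mult A" "2 * e < mult_size \<sigma>"
      using that by (simp_all add: certifies_def)
    then show ?thesis
      using rtrancl_trans[OF path_up[OF \<rho>\<sigma>(1) _ sup] path_sym[OF path_up[OF \<rho>\<sigma>(2) _ sup]]] by simp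
  qed
  have "(\<mu>', \<nu>') \<in> adjacency\<^sup>*"
  proof (cases "e \<le> e'")
    case True
    have "\<phi> \<in> Dmod A l \<nu>'" using Dmod_proportional[OF _ \<psi>(4) det(2)] \<psi>(1) by (simp add: certifies_def)
    then show ?thesis using join[OF \<phi>(1) \<psi>(1)] True by blast
  next
    case False
    have "\<psi> \<in> Dmod A l \<mu>'" using Dmod_proportional[OF _ \<phi>(4) det(1)] \<phi>(1) by (simp add: certifies_def)
    then have "(\<nu>', \<mu>') \<in> adjacency\<^sup>*" using join[OF \<psi>(1) \<phi>(1)] False by simp
    then show ?thesis by (rule path_sym)
  qed
  then show ?thesis by (rule rtrancl_trans[OF \<phi>(2) rtrancl_trans[OF _ path_sym[OF \<psi>(2)]]])
qed

section \<open>Maximal connected components as reachability classes\<close>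

lemma component_eq:
  assumes C: "C \<in> hasse_components A (Mult' A l)" and "\<mu> \<in> C"
  shows "C = adjacency\<^sup>* `` {\<mu>}"
proof -
  let ?X = "adjacency\<^sup>* `` {\<mu>}"
  have CM: "C \<subseteq> Mult' A l" and conn: "hasse_connected A C"
    and maximal: "\<And>C'. C \<subseteq> C' \<Longrightarrow> C' \<subseteq> Mult' A l \<Longrightarrow> hasse_connected A C' \<Longrightarrow> C' = C"
    using C by (auto simp: hasse_components_def)
  have "Restr (hasse A) C \<subseteq> adjacency" using CM by (auto simp: adjacency_def)
  then have "C \<subseteq> ?X"
    using conn \<open>\<mu> \<in> C\<close> rtrancl_mono unfolding hasse_connected_def by blast
  have XM: "?X \<subseteq> Mult' A l"
  proof
    fix \<kappa> assume "\<kappa> \<in> ?X"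
    then have "(\<mu>, \<kappa>) \<in> adjacency\<^sup>*" by simp
    then show "\<kappa> \<in> Mult' A l"
      by (cases rule: rtranclE) (use \<open>\<mu> \<in> C\<close> CM in \<open>auto simp: adjacency_def\<close>)
  qed
  \<comment> \<open>Every vertex on a path from \<open>\<mu>\<close> is itself reachable, so the
    path stays inside the class. The class is therefore connected, and maximality of
    \<open>C\<close> applies to it.\<close>
  have reach: "(\<mu>, \<kappa>) \<in> (Restr (hasse A) ?X)\<^sup>*" if "(\<mu>, \<kappa>) \<in> adjacency\<^sup>*" for \<kappa>
    using that
  proof (induction rule: rtrancl_induct)
    case (step \<kappa> \<kappa>')
    then have "(\<kappa>, \<kappa>') \<in> Restr (hasse A) ?X"
      by (auto simp: adjacency_def intro: rtrancl_into_rtrancl)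
    then show ?case using step.IH by (rule rtrancl_into_rtrancl[rotated])
  qed simp
  have "sym (Restr (hasse A) ?X)" by (auto simp: sym_def hasse_def)
  then have "(\<kappa>, \<mu>) \<in> (Restr (hasse A) ?X)\<^sup>*" if "\<kappa> \<in> ?X" for \<kappa>
    using reach that sym_rtrancl symD by fastforce
  then have "hasse_connected A ?X"
    unfolding hasse_connected_def using XM reach
    by (auto simp: Mult'_def intro: rtrancl_trans)
  then show ?thesis using maximal \<open>C \<subseteq> ?X\<close> XM by blast
qed

section \<open>Degree count for the scaled derivations\<close>

lemma is_theta_degree:
  assumes "is_theta A l \<mu> \<theta>" "\<mu> \<in> Mult A"
  obtains d where "certifies \<mu> \<theta> d" "Delta A l \<mu> = int (mult_size \<mu>) - 2 * int d"
proof -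
  obtain \<theta>' d d' where basis: "homogeneous_basis_degs (Dmod A l \<mu>) \<theta> \<theta>' d d'" "d < d'"
    using assms(1) by (auto simp: is_theta_def)
  note b = homogeneous_basis_degsD[OF basis(1)]
  have "\<theta> \<noteq> 0" using b(5) by (auto simp: der_det_def)
  then have "certifies \<mu> \<theta> d" using b basis(2) assms(2) by (simp add: certifies_def)
  moreover have "Delta A l \<mu> = int (mult_size \<mu>) - 2 * int d"
    using Delta_eq[OF basis(1)] b(6) basis(2) by linarith
  ultimately show ?thesis by (rule that)
qed

lemma alpha_prod_Dmod:
  assumes "\<theta> \<in> Dmod A l \<mu>"
  shows "der_scale (alpha_prod A l \<mu> \<kappa>) \<theta> \<in> Dmod A l \<kappa>"
  unfolding Dmod_def
proof (intro CollectI ballI)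
  fix H assume H: "H \<in> A"
  have "l H ^ (\<kappa> H - \<mu> H) dvd alpha_prod A l \<mu> \<kappa>"
    unfolding alpha_prod_def using finite_A H by (rule dvd_prodI)
  moreover have "l H ^ \<mu> H dvd der_apply \<theta> (l H)" using assms H by (simp add: Dmod_def)
  ultimately have "l H ^ ((\<kappa> H - \<mu> H) + \<mu> H) dvd alpha_prod A l \<mu> \<kappa> * der_apply \<theta> (l H)"
    unfolding power_add by (rule mult_dvd_mono)
  then show "l H ^ \<kappa> H dvd der_apply (der_scale (alpha_prod A l \<mu> \<kappa>) \<theta>) (l H)"
    unfolding der_apply_scale by (rule power_le_dvd) simp
qed

lemma alpha_prod_nonzero: "alpha_prod A l \<mu> \<kappa> \<noteq> 0"
  unfolding alpha_prod_def using finite_A l_nonzero by simp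

lemma homogeneous_alpha_prod: "homogeneous (\<Sum>H\<in>A. \<kappa> H - \<mu> H) (alpha_prod A l \<mu> \<kappa>)"
  using homogeneous_Q[of "\<lambda>H. \<kappa> H - \<mu> H"] by (simp add: Q_def mult_size_def alpha_prod_def)

text \<open>Summed over \<open>H\<close>, this is the equality of degrees required by Saito's criterion.\<close>

lemma interval_identity:
  fixes m n k :: nat
  assumes "min m n \<le> k" "k \<le> max m n"
  shows "2 * int (k - m) + 2 * int (k - n) + int m + int n - \<bar>int m - int n\<bar> = 2 * int k"
  using assms by (auto simp: min_def max_def split: if_splits)

lemma scaled_thetas_basis:
  assumes "is_theta A l \<mu> \<theta>" "is_theta A l \<nu> \<theta>'" "\<mu> \<in> Mult A" "\<nu> \<in> Mult A"
    and "(\<mu>, \<nu>) \<notin> adjacency\<^sup>*"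
    and Delta: "Delta A l \<mu> + Delta A l \<nu> = mult_dist A \<mu> \<nu>"
    and \<kappa>: "inf \<mu> \<nu> \<le> \<kappa>" "\<kappa> \<le> sup \<mu> \<nu>"
  shows "homogeneous_basis (Dmod A l \<kappa>)
    (der_scale (alpha_prod A l \<mu> \<kappa>) \<theta>) (der_scale (alpha_prod A l \<nu> \<kappa>) \<theta>')"
proof -
  obtain d where d: "certifies \<mu> \<theta> d" "Delta A l \<mu> = int (mult_size \<mu>) - 2 * int d"
    using is_theta_degree assms by blast
  obtain d' where d': "certifies \<nu> \<theta>' d'" "Delta A l \<nu> = int (mult_size \<nu>) - 2 * int d'"
    using is_theta_degree assms by blast
  let ?m = "\<Sum>H\<in>A. \<kappa> H - \<mu> H" and ?n = "\<Sum>H\<in>A. \<kappa> H - \<nu> H"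
  have "(\<Sum>H\<in>A. 2 * int (\<kappa> H - \<mu> H) + 2 * int (\<kappa> H - \<nu> H) + int (\<mu> H) + int (\<nu> H)
      - \<bar>int (\<mu> H) - int (\<nu> H)\<bar>) = (\<Sum>H\<in>A. 2 * int (\<kappa> H))"
    using \<kappa> by (intro sum.cong refl interval_identity) (auto simp: le_fun_def inf_min sup_max)
  then have "2 * int ?m + 2 * int ?n + int (mult_size \<mu>) + int (mult_size \<nu>) - mult_dist A \<mu> \<nu> =
      2 * int (mult_size \<kappa>)"
    by (simp add: sum.distrib sum_subtractf mult_size_def mult_dist_def flip: sum_distrib_left)
  \<comment> \<open>The hypothesis replaces the distance by
    \<open>mult_size \<mu> - 2 * d + mult_size \<nu> - 2 * d'\<close>; the sizes of
    \<open>\<mu>\<close> and \<open>\<nu>\<close> cancel and a factor 2 is divided out.\<close>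
  then have "(?m + d) + (?n + d') = mult_size \<kappa>"
    using Delta d(2) d'(2) by linarith
  moreover have "der_det \<theta> \<theta>' \<noteq> 0" using path_if_proportional d(1) d'(1) assms(5) by blast
  ultimately show ?thesis
    unfolding homogeneous_basis_def
    using d(1) d'(1) alpha_prod_nonzero
    by (intro exI saito_criterion)
      (auto simp: certifies_def der_det_scale
        intro: alpha_prod_Dmod der_homogeneous_scale homogeneous_alpha_prod)
qed

end

section \<open>From lines in a plane to linear forms in two variables\<close>

lemma line_arrangement_form_poly:
  fixes scale :: "'k::field \<Rightarrow> 'v::ab_group_add \<Rightarrow> 'v"
  assumes "vector_space scale" "e1 \<noteq> e2"
    and indep: "\<not> module.dependent scale {e1, e2}"
    and span: "module.span scale {e1, e2} = UNIV"
    and "finite A"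
    and dim: "\<And>H. H \<in> A \<Longrightarrow> vector_space.dim scale H = 1"
    and form: "\<And>H. H \<in> A \<Longrightarrow> Vector_Spaces.linear scale (*) (\<alpha> H) \<and> {v. \<alpha> H v = 0} = H"
  shows "line_arrangement A (\<lambda>H. form_poly e1 e2 (\<alpha> H))"
proof -
  interpret vector_space scale by fact
  have \<alpha>: "\<exists>a b. v = scale a e1 + scale b e2 \<and> (\<forall>H\<in>A. \<alpha> H v = a * \<alpha> H e1 + b * \<alpha> H e2)" for v
  proof -
    have "v \<in> span {e1, e2}" using span by simp
    then obtain a b where v: "v = scale a e1 + scale b e2"
      by (auto simp: span_insert span_singleton algebra_simps)
    have "\<alpha> H v = a * \<alpha> H e1 + b * \<alpha> H e2" if "H \<in> A" for H
    proof -
      interpret Vector_Spaces.linear scale "(*)" "\<alpha> H" using form that by blast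
      show ?thesis by (simp add: v add scale)
    qed
    then show ?thesis using v by blast
  qed
  have nonzero: "\<alpha> H e1 \<noteq> 0 \<or> \<alpha> H e2 \<noteq> 0" if "H \<in> A" for H
  proof (rule ccontr)
    assume "\<not> ?thesis"
    then have "\<alpha> H v = 0" for v using \<alpha>[of v] that by auto
    \<comment> \<open>A form vanishing on the basis would have the whole plane as kernel, of
      dimension 2 instead of 1.\<close>
    then have "H = span {e1, e2}" using form[OF that] span by auto
    then have "dim H = 2" using dim_span_eq_card_independent[OF indep] \<open>e1 \<noteq> e2\<close> by simp
    then show False using dim[OF that] by simp
  qed
  have not_dvd: "\<not> form_poly e1 e2 (\<alpha> H) dvd form_poly e1 e2 (\<alpha> K)" if HK: "H \<in> A" "K \<in> A" "H \<noteq> K" for H K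
  proof
    assume "form_poly e1 e2 (\<alpha> H) dvd form_poly e1 e2 (\<alpha> K)"
    then obtain r where r: "form_poly e1 e2 (\<alpha> K) = r * form_poly e1 e2 (\<alpha> H)"
      by (metis dvdE mult.commute)
    have lin: "homogeneous 1 (form_poly e1 e2 f)" for f :: "'v \<Rightarrow> 'k"
      unfolding form_poly_def by (rule homogeneous_linear)
    have "form_poly e1 e2 (\<alpha> H) \<noteq> 0" using nonzero HK by (auto simp: form_poly_def)
    \<comment> \<open>A quotient of two linear forms has degree 0, so it is a constant, nonzero
      because the second form is. The forms then have equal kernels, against the distinctness of the
      lines.\<close>
    then have "homogeneous 0 r"
      using homogeneous_quotient[OF _ lin, of 0 r] lin[of "\<alpha> K"] r by simp
    then obtain c where c: "r = [:[:c:]:]" by (rule homogeneous_0_imp_const)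
    have eq: "\<alpha> K e1 = c * \<alpha> H e1" "\<alpha> K e2 = c * \<alpha> H e2"
      using r by (auto simp: form_poly_def c)
    then have "c \<noteq> 0" using nonzero[OF HK(2)] by auto
    have "\<alpha> K v = c * \<alpha> H v" for v
      using \<alpha>[of v] HK eq by (auto simp: algebra_simps)
    then have "{v. \<alpha> K v = 0} = {v. \<alpha> H v = 0}" using \<open>c \<noteq> 0\<close> by simp
    then show False using form HK by metis
  qed
  show ?thesis
    by unfold_locales (use \<open>finite A\<close> nonzero not_dvd in \<open>auto simp: form_poly_def\<close>)
qed

theorem theorem3p9:
  fixes scale :: "'k::field \<Rightarrow> 'v::ab_group_add \<Rightarrow> 'v"
    and e1 e2 :: 'v
    and A :: "'v set set"
    and \<alpha> :: "'v set \<Rightarrow> 'v \<Rightarrow> 'k"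
    and l :: "'v set \<Rightarrow> 'k poly poly"
    and \<mu> \<nu> \<kappa> :: "'v set \<Rightarrow> nat"
    and \<theta>\<mu> \<theta>\<nu> :: "'k der"
  assumes "vector_space scale"
    and "e1 \<noteq> e2"
    and "\<not> module.dependent scale {e1, e2}"
    and "module.span scale {e1, e2} = UNIV"
    and "finite A"
    and "\<And>H. H \<in> A \<Longrightarrow> module.subspace scale H \<and> vector_space.dim scale H = 1"
    and "\<And>H. H \<in> A \<Longrightarrow> Vector_Spaces.linear scale (*) (\<alpha> H) \<and> {v. \<alpha> H v = 0} = H"
    and "l = (\<lambda>H. form_poly e1 e2 (\<alpha> H))"
    and "C\<^sub>1 \<in> hasse_components A (Mult' A l)" and "\<mu> \<in> C\<^sub>1"
    and "C\<^sub>2 \<in> hasse_components A (Mult' A l)" and "\<nu> \<in> C\<^sub>2"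
    and "C\<^sub>1 \<noteq> C\<^sub>2"
    and "Delta A l \<mu> + Delta A l \<nu> = mult_dist A \<mu> \<nu>"
    and "is_theta A l \<mu> \<theta>\<mu>" and "is_theta A l \<nu> \<theta>\<nu>"
    and "\<kappa> \<in> Mult A" and "inf \<mu> \<nu> \<le> \<kappa>" and "\<kappa> \<le> sup \<mu> \<nu>"
  shows "homogeneous_basis (Dmod A l \<kappa>)
           (der_scale (alpha_prod A l \<mu> \<kappa>) \<theta>\<mu>) (der_scale (alpha_prod A l \<nu> \<kappa>) \<theta>\<nu>)"
proof -
  interpret line_arrangement A l
    unfolding assms(8) by (rule line_arrangement_form_poly) (use assms(1-7) in blast)+
  have C: "C\<^sub>1 = adjacency\<^sup>* `` {\<mu>}" "C\<^sub>2 = adjacency\<^sup>* `` {\<nu>}"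
    using component_eq assms(9-12) by blast+
  have "(\<mu>, \<nu>) \<notin> adjacency\<^sup>*"
  proof
    assume "(\<mu>, \<nu>) \<in> adjacency\<^sup>*"
    then have "C\<^sub>1 = C\<^sub>2" unfolding C using path_sym by (auto intro: rtrancl_trans)
    then show False using assms(13) by blast
  qed
  moreover have "\<mu> \<in> Mult A" "\<nu> \<in> Mult A"
    using assms(9-12) by (auto simp: hasse_components_def Mult'_def)
  ultimately show ?thesis using scaled_thetas_basis assms by blast
qed

end
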